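(* (a) Let $\mathcal{L}$ be a modal logic in the language $Fm_\square$ containing $\mathit{S1SP}$. Then for any $\varphi\in Fm_\square$: $\ \vdash_{\mathcal{L}}\varphi\equiv\mathit{box}(\mathit{id}(\varphi))$. (b) Let $\mathcal{L}_\equiv$ be an axiomatic extension of $\mathit{SCI}$ in the language $Fm_\equiv$ containing as theorems all formulas of the form $(\chi\equiv\psi)\equiv\square(\chi\leftrightarrow\psi)$ (that is, $(\chi\equiv\psi)\equiv((\chi\leftrightarrow\psi)\equiv\top)$). Then for any $\varphi\in Fm_\equiv$: $\ \vdash_{\mathcal{L}_\equiv}\varphi\equiv\mathit{id}(\mathit{box}(\varphi))$.
   Context: Languages: $Fm_\equiv$ is the set of formulas built from variables $V=\{x_0,x_1,\dots\}$, $\bot,\top,\neg,\vee,\wedge,\rightarrow$ and a binary connective $\equiv$. $Fm_\square$ is built from the same variables and classical connectives and a unary operator $\square$. $\varphi\leftrightarrow\psi$ abbreviates $(\varphi\rightarrow\psi)\wedge(\psi\rightarrow\varphi)$. In $Fm_\equiv$, $\square\varphi$ abbreviates $\varphi\equiv\top$. In $Fm_\square$, $\varphi\equiv\psi$ abbreviates $\square(\varphi\leftrightarrow\psi)$. $\mathit{SCI}$ (in $Fm_\equiv$): axioms are all substitution instances of classical tautologies and all formulas $\varphi\equiv\varphi$; $(\varphi\equiv\psi)\rightarrow(\varphi\rightarrow\psi)$; $(\varphi\equiv\psi)\rightarrow(\neg\varphi\equiv\neg\psi)$; $((\varphi_1\equiv\psi_1)\wedge(\varphi_2\equiv\psi_2))\rightarrow((\varphi_1*\varphi_2)\equiv(\psi_1*\psi_2))$,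 $*\in\{\vee,\wedge,\rightarrow,\equiv\}$; rule Modus Ponens (MP). An axiomatic extension of $\mathit{SCI}$ adds further formulas as axioms/theorems, with MP as rule. $\mathit{S1SP}$ (in $Fm_\square$): axioms are all substitution instances of classical tautologies, $\square\varphi\rightarrow\varphi$, and $(\square(\varphi\rightarrow\psi)\wedge\square(\psi\rightarrow\chi))\rightarrow\square(\varphi\rightarrow\chi)$; theorems are generated from these axioms, from $\square\varphi$ for each axiom $\varphi$ (Axiom Necessitation), and from all instances of the Substitution Principle SP, $(\varphi\equiv\psi)\rightarrow(\chi[x:=\varphi]\equiv\chi[x:=\psi])$ (to which Axiom Necessitation is not applied), by MP. A modal logic containing $\mathit{S1SP}$ is one whose theorems include those of $\mathit{S1SP}$ and are closed under MP. Translations: $\mathit{box}\colon Fm_\equiv\to Fm_\square$ is the identity on variables, $\bot$, $\top$, commutes with $\neg,\wedge,\vee,\rightarrow$, and $\mathit{box}(\varphi\equiv\psi):=\square(\mathit{box}(\varphi)\leftrightarrow\mathit{box}(\psi))$. $\mathit{id}\colon Fm_\square\to Fm_\equiv$ is the identity on variables, $\bot$, $\top$, commutes with $\neg,\wedge,\vee,\rightarrow$, and $\mathit{id}(\square\varphi):=(\mathit{id}(\varphi)\equiv\top)$. *)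

theory Defs
  imports Main
begin

section \<open>Classical tautologies\<close>

datatype pfm =
    PVar nat
  | PBot
  | PTop
  | PNeg pfm
  | POr pfm pfm
  | PAnd pfm pfm
  | PImp pfm pfm

primrec peval :: "(nat \<Rightarrow> bool) \<Rightarrow> pfm \<Rightarrow> bool" where
  "peval v (PVar n) = v n"
| "peval v PBot = False"
| "peval v PTop = True"
| "peval v (PNeg p) = (\<not> peval v p)"
| "peval v (POr p q) = (peval v p \<or> peval v q)"
| "peval v (PAnd p q) = (peval v p \<and> peval v q)"
| "peval v (PImp p q) = (peval v p \<longrightarrow> peval v q)"

definition tautology :: "pfm \<Rightarrow> bool" where
  "tautology p \<longleftrightarrow> (\<forall>v. peval v p)"


section \<open>The languages\<close>

text \<open>Connectives of the language with propositional identity carry the subscript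
  \<open>\<equiv>\<close>, those of the modal language the subscript \<open>\<box>\<close>.\<close>

datatype fm_eq =
    VarE nat
  | BotE ("\<bottom>\<^sub>\<equiv>")
  | TopE ("\<top>\<^sub>\<equiv>")
  | NegE fm_eq ("\<not>\<^sub>\<equiv> _" [80] 80)
  | OrE fm_eq fm_eq (infixr "\<or>\<^sub>\<equiv>" 70)
  | AndE fm_eq fm_eq (infixr "\<and>\<^sub>\<equiv>" 75)
  | ImpE fm_eq fm_eq (infixr "\<rightarrow>\<^sub>\<equiv>" 60)
  | IdE fm_eq fm_eq (infix "\<equiv>\<^sub>\<equiv>" 65)

abbreviation IffE :: "fm_eq \<Rightarrow> fm_eq \<Rightarrow> fm_eq" (infix "\<leftrightarrow>\<^sub>\<equiv>" 55) where
  "\<phi> \<leftrightarrow>\<^sub>\<equiv> \<psi> \<equiv> (\<phi> \<rightarrow>\<^sub>\<equiv> \<psi>) \<and>\<^sub>\<equiv> (\<psi> \<rightarrow>\<^sub>\<equiv> \<phi>)"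

abbreviation BoxE :: "fm_eq \<Rightarrow> fm_eq" ("\<box>\<^sub>\<equiv> _" [80] 80) where
  "\<box>\<^sub>\<equiv> \<phi> \<equiv> (\<phi> \<equiv>\<^sub>\<equiv> \<top>\<^sub>\<equiv>)"

datatype fm_box =
    VarB nat
  | BotB ("\<bottom>\<^sub>\<box>")
  | TopB ("\<top>\<^sub>\<box>")
  | NegB fm_box ("\<not>\<^sub>\<box> _" [80] 80)
  | OrB fm_box fm_box (infixr "\<or>\<^sub>\<box>" 70)
  | AndB fm_box fm_box (infixr "\<and>\<^sub>\<box>" 75)
  | ImpB fm_box fm_box (infixr "\<rightarrow>\<^sub>\<box>" 60)
  | BoxB fm_box ("\<box>\<^sub>\<box> _" [80] 80)

abbreviation IffB :: "fm_box \<Rightarrow> fm_box \<Rightarrow> fm_box" (infix "\<leftrightarrow>\<^sub>\<box>" 55) where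
  "\<phi> \<leftrightarrow>\<^sub>\<box> \<psi> \<equiv> (\<phi> \<rightarrow>\<^sub>\<box> \<psi>) \<and>\<^sub>\<box> (\<psi> \<rightarrow>\<^sub>\<box> \<phi>)"

abbreviation IdB :: "fm_box \<Rightarrow> fm_box \<Rightarrow> fm_box" (infix "\<equiv>\<^sub>\<box>" 65) where
  "\<phi> \<equiv>\<^sub>\<box> \<psi> \<equiv> \<box>\<^sub>\<box> (\<phi> \<leftrightarrow>\<^sub>\<box> \<psi>)"


section \<open>Substitution\<close>

text \<open>A substitution instance of a classical tautology arises by simultaneously replacing
  its propositional variables by formulas of the respective language.\<close>

primrec inst_eq :: "(nat \<Rightarrow> fm_eq) \<Rightarrow> pfm \<Rightarrow> fm_eq" where
  "inst_eq \<sigma> (PVar n) = \<sigma> n"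
| "inst_eq \<sigma> PBot = \<bottom>\<^sub>\<equiv>"
| "inst_eq \<sigma> PTop = \<top>\<^sub>\<equiv>"
| "inst_eq \<sigma> (PNeg p) = \<not>\<^sub>\<equiv> (inst_eq \<sigma> p)"
| "inst_eq \<sigma> (POr p q) = (inst_eq \<sigma> p \<or>\<^sub>\<equiv> inst_eq \<sigma> q)"
| "inst_eq \<sigma> (PAnd p q) = (inst_eq \<sigma> p \<and>\<^sub>\<equiv> inst_eq \<sigma> q)"
| "inst_eq \<sigma> (PImp p q) = (inst_eq \<sigma> p \<rightarrow>\<^sub>\<equiv> inst_eq \<sigma> q)"

primrec inst_box :: "(nat \<Rightarrow> fm_box) \<Rightarrow> pfm \<Rightarrow> fm_box" where
  "inst_box \<sigma> (PVar n) = \<sigma> n"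
| "inst_box \<sigma> PBot = \<bottom>\<^sub>\<box>"
| "inst_box \<sigma> PTop = \<top>\<^sub>\<box>"
| "inst_box \<sigma> (PNeg p) = \<not>\<^sub>\<box> (inst_box \<sigma> p)"
| "inst_box \<sigma> (POr p q) = (inst_box \<sigma> p \<or>\<^sub>\<box> inst_box \<sigma> q)"
| "inst_box \<sigma> (PAnd p q) = (inst_box \<sigma> p \<and>\<^sub>\<box> inst_box \<sigma> q)"
| "inst_box \<sigma> (PImp p q) = (inst_box \<sigma> p \<rightarrow>\<^sub>\<box> inst_box \<sigma> q)"

text \<open>\<open>subst_box \<chi> x \<phi>\<close> is \<open>\<chi>[x := \<phi>]\<close>.\<close>

primrec subst_box :: "fm_box \<Rightarrow> nat \<Rightarrow> fm_box \<Rightarrow> fm_box" where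
  "subst_box (VarB n) x \<phi> = (if n = x then \<phi> else VarB n)"
| "subst_box \<bottom>\<^sub>\<box> x \<phi> = \<bottom>\<^sub>\<box>"
| "subst_box \<top>\<^sub>\<box> x \<phi> = \<top>\<^sub>\<box>"
| "subst_box (\<not>\<^sub>\<box> \<chi>) x \<phi> = \<not>\<^sub>\<box> (subst_box \<chi> x \<phi>)"
| "subst_box (\<chi> \<or>\<^sub>\<box> \<xi>) x \<phi> = (subst_box \<chi> x \<phi> \<or>\<^sub>\<box> subst_box \<xi> x \<phi>)"
| "subst_box (\<chi> \<and>\<^sub>\<box> \<xi>) x \<phi> = (subst_box \<chi> x \<phi> \<and>\<^sub>\<box> subst_box \<xi> x \<phi>)"
| "subst_box (\<chi> \<rightarrow>\<^sub>\<box> \<xi>) x \<phi> = (subst_box \<chi> x \<phi> \<rightarrow>\<^sub>\<box> subst_box \<xi> x \<phi>)"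
| "subst_box (\<box>\<^sub>\<box> \<chi>) x \<phi> = \<box>\<^sub>\<box> (subst_box \<chi> x \<phi>)"


section \<open>The logic SCI and its axiomatic extensions\<close>

inductive_set SCI_axioms :: "fm_eq set" where
  taut: "tautology p \<Longrightarrow> inst_eq \<sigma> p \<in> SCI_axioms"
| refl: "(\<phi> \<equiv>\<^sub>\<equiv> \<phi>) \<in> SCI_axioms"
| elim: "((\<phi> \<equiv>\<^sub>\<equiv> \<psi>) \<rightarrow>\<^sub>\<equiv> (\<phi> \<rightarrow>\<^sub>\<equiv> \<psi>)) \<in> SCI_axioms"
| cong_Neg: "((\<phi> \<equiv>\<^sub>\<equiv> \<psi>) \<rightarrow>\<^sub>\<equiv> ((\<not>\<^sub>\<equiv> \<phi>) \<equiv>\<^sub>\<equiv> (\<not>\<^sub>\<equiv> \<psi>))) \<in> SCI_axioms"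
| cong_bin: "c \<in> {OrE, AndE, ImpE, IdE} \<Longrightarrow>
    (((\<phi>\<^sub>1 \<equiv>\<^sub>\<equiv> \<psi>\<^sub>1) \<and>\<^sub>\<equiv> (\<phi>\<^sub>2 \<equiv>\<^sub>\<equiv> \<psi>\<^sub>2)) \<rightarrow>\<^sub>\<equiv> ((c \<phi>\<^sub>1 \<phi>\<^sub>2) \<equiv>\<^sub>\<equiv> (c \<psi>\<^sub>1 \<psi>\<^sub>2))) \<in> SCI_axioms"

text \<open>Theorems of SCI extended by the additional axioms \<open>\<A>\<close>; SCI itself is
  the case \<open>\<A> = {}\<close>.\<close>

inductive_set SCI_theorems :: "fm_eq set \<Rightarrow> fm_eq set" for \<A> :: "fm_eq set" where
  ax: "\<phi> \<in> SCI_axioms \<Longrightarrow> \<phi> \<in> SCI_theorems \<A>"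
| extra: "\<phi> \<in> \<A> \<Longrightarrow> \<phi> \<in> SCI_theorems \<A>"
| MP: "\<phi> \<in> SCI_theorems \<A> \<Longrightarrow> (\<phi> \<rightarrow>\<^sub>\<equiv> \<psi>) \<in> SCI_theorems \<A> \<Longrightarrow> \<psi> \<in> SCI_theorems \<A>"

text \<open>A logic is identified with its set of theorems. Neither the added axioms here nor the
  modal logics below are required to be closed under uniform substitution.\<close>

definition axiomatic_extension_SCI :: "fm_eq set \<Rightarrow> bool" where
  "axiomatic_extension_SCI L \<longleftrightarrow> (\<exists>\<A>. L = SCI_theorems \<A>)"


section \<open>The logic S1SP and modal logics containing it\<close>

inductive_set S1SP_axioms :: "fm_box set" where
  taut: "tautology p \<Longrightarrow> inst_box \<sigma> p \<in> S1SP_axioms"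
| T: "(\<box>\<^sub>\<box> \<phi> \<rightarrow>\<^sub>\<box> \<phi>) \<in> S1SP_axioms"
| trans: "((\<box>\<^sub>\<box> (\<phi> \<rightarrow>\<^sub>\<box> \<psi>) \<and>\<^sub>\<box> \<box>\<^sub>\<box> (\<psi> \<rightarrow>\<^sub>\<box> \<chi>)) \<rightarrow>\<^sub>\<box> \<box>\<^sub>\<box> (\<phi> \<rightarrow>\<^sub>\<box> \<chi>)) \<in> S1SP_axioms"

inductive_set S1SP_theorems :: "fm_box set" where
  ax: "\<phi> \<in> S1SP_axioms \<Longrightarrow> \<phi> \<in> S1SP_theorems"
| AN: "\<phi> \<in> S1SP_axioms \<Longrightarrow> \<box>\<^sub>\<box> \<phi> \<in> S1SP_theorems"
| SP: "((\<phi> \<equiv>\<^sub>\<box> \<psi>) \<rightarrow>\<^sub>\<box> (subst_box \<chi> x \<phi> \<equiv>\<^sub>\<box> subst_box \<chi> x \<psi>)) \<in> S1SP_theorems"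
| MP: "\<phi> \<in> S1SP_theorems \<Longrightarrow> (\<phi> \<rightarrow>\<^sub>\<box> \<psi>) \<in> S1SP_theorems \<Longrightarrow> \<psi> \<in> S1SP_theorems"

definition modal_logic_containing_S1SP :: "fm_box set \<Rightarrow> bool" where
  "modal_logic_containing_S1SP L \<longleftrightarrow>
     S1SP_theorems \<subseteq> L \<and> (\<forall>\<phi> \<psi>. \<phi> \<in> L \<longrightarrow> (\<phi> \<rightarrow>\<^sub>\<box> \<psi>) \<in> L \<longrightarrow> \<psi> \<in> L)"


section \<open>The translations\<close>

primrec box_tr :: "fm_eq \<Rightarrow> fm_box" where
  "box_tr (VarE n) = VarB n"
| "box_tr \<bottom>\<^sub>\<equiv> = \<bottom>\<^sub>\<box>"
| "box_tr \<top>\<^sub>\<equiv> = \<top>\<^sub>\<box>"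
| "box_tr (\<not>\<^sub>\<equiv> \<phi>) = \<not>\<^sub>\<box> (box_tr \<phi>)"
| "box_tr (\<phi> \<or>\<^sub>\<equiv> \<psi>) = (box_tr \<phi> \<or>\<^sub>\<box> box_tr \<psi>)"
| "box_tr (\<phi> \<and>\<^sub>\<equiv> \<psi>) = (box_tr \<phi> \<and>\<^sub>\<box> box_tr \<psi>)"
| "box_tr (\<phi> \<rightarrow>\<^sub>\<equiv> \<psi>) = (box_tr \<phi> \<rightarrow>\<^sub>\<box> box_tr \<psi>)"
| "box_tr (\<phi> \<equiv>\<^sub>\<equiv> \<psi>) = \<box>\<^sub>\<box> (box_tr \<phi> \<leftrightarrow>\<^sub>\<box> box_tr \<psi>)"

primrec id_tr :: "fm_box \<Rightarrow> fm_eq" where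
  "id_tr (VarB n) = VarE n"
| "id_tr \<bottom>\<^sub>\<box> = \<bottom>\<^sub>\<equiv>"
| "id_tr \<top>\<^sub>\<box> = \<top>\<^sub>\<equiv>"
| "id_tr (\<not>\<^sub>\<box> \<phi>) = \<not>\<^sub>\<equiv> (id_tr \<phi>)"
| "id_tr (\<phi> \<or>\<^sub>\<box> \<psi>) = (id_tr \<phi> \<or>\<^sub>\<equiv> id_tr \<psi>)"
| "id_tr (\<phi> \<and>\<^sub>\<box> \<psi>) = (id_tr \<phi> \<and>\<^sub>\<equiv> id_tr \<psi>)"
| "id_tr (\<phi> \<rightarrow>\<^sub>\<box> \<psi>) = (id_tr \<phi> \<rightarrow>\<^sub>\<equiv> id_tr \<psi>)"
| "id_tr (\<box>\<^sub>\<box> \<phi>) = (id_tr \<phi> \<equiv>\<^sub>\<equiv> \<top>\<^sub>\<equiv>)"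

end

(* Both parts go by induction on formulas, using that provable identity is a congruence. The
   only case where a translation round trip changes a formula is that of the modal operator,
   respectively of the identity connective. In S1SP it is settled by the tautology
   phi <-> (phi <-> true), to which Axiom Necessitation and then SP apply, and in the
   extension of SCI by the additional theorems. *)
theory Submission
  imports Defs
begin

text \<open>Supplies variables not occurring in \<open>\<chi>\<close>, so that SP can act on one
  argument of a compound formula while leaving another fixed. Freshness is stated for all large
  \<open>x\<close> so that the bounds of two subformulas combine through \<open>max\<close>.\<close>

lemma eventually_subst_box_fresh:
  "\<exists>n. \<forall>x\<ge>n. \<forall>\<phi>. subst_box \<chi> x \<phi> = \<chi>"
proof (induction \<chi>)
  case (VarB k)
  show ?case by (rule exI[of _ "Suc k"]) auto
next
  case (OrB \<chi> \<xi>)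
  then obtain m n where "\<forall>x\<ge>m. \<forall>\<phi>. subst_box \<chi> x \<phi> = \<chi>" "\<forall>x\<ge>n. \<forall>\<phi>. subst_box \<xi> x \<phi> = \<xi>"
    by blast
  then show ?case by (intro exI[of _ "max m n"]) simp
next
  case (AndB \<chi> \<xi>)
  then obtain m n where "\<forall>x\<ge>m. \<forall>\<phi>. subst_box \<chi> x \<phi> = \<chi>" "\<forall>x\<ge>n. \<forall>\<phi>. subst_box \<xi> x \<phi> = \<xi>"
    by blast
  then show ?case by (intro exI[of _ "max m n"]) simp
next
  case (ImpB \<chi> \<xi>)
  then obtain m n where "\<forall>x\<ge>m. \<forall>\<phi>. subst_box \<chi> x \<phi> = \<chi>" "\<forall>x\<ge>n. \<forall>\<phi>. subst_box \<xi> x \<phi> = \<xi>"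
    by blast
  then show ?case by (intro exI[of _ "max m n"]) simp
qed auto

lemma S1SP_box_taut: "tautology p \<Longrightarrow> \<box>\<^sub>\<box> (inst_box \<sigma> p) \<in> S1SP_theorems"
  by (intro S1SP_theorems.AN S1SP_axioms.taut)

lemma S1SP_T: "\<box>\<^sub>\<box> \<phi> \<in> S1SP_theorems \<Longrightarrow> \<phi> \<in> S1SP_theorems"
  by (rule S1SP_theorems.MP[OF _ S1SP_theorems.ax[OF S1SP_axioms.T]])

lemma S1SP_id_refl: "(\<phi> \<equiv>\<^sub>\<box> \<phi>) \<in> S1SP_theorems"
proof -
  let ?p = "PAnd (PImp (PVar 0) (PVar 0)) (PImp (PVar 0) (PVar 0))"
  have "tautology ?p" by (simp add: tautology_def)
  from S1SP_box_taut[OF this, of "\<lambda>_. \<phi>"] show ?thesis by simp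
qed

text \<open>The right-hand side is the form that a formula takes under the box after a round trip,
  since \<open>id_tr\<close> turns a box into an identity with the top element.\<close>

lemma S1SP_id_iff_Top: "(\<phi> \<equiv>\<^sub>\<box> (\<phi> \<leftrightarrow>\<^sub>\<box> \<top>\<^sub>\<box>)) \<in> S1SP_theorems"
proof -
  let ?q = "PAnd (PImp (PVar 0) PTop) (PImp PTop (PVar 0))"
  let ?p = "PAnd (PImp (PVar 0) ?q) (PImp ?q (PVar 0))"
  have "tautology ?p" by (simp add: tautology_def)
  from S1SP_box_taut[OF this, of "\<lambda>_. \<phi>"] show ?thesis by simp
qed

lemma S1SP_id_imp:
  assumes "(\<phi> \<equiv>\<^sub>\<box> \<psi>) \<in> S1SP_theorems"
  shows "(\<phi> \<rightarrow>\<^sub>\<box> \<psi>) \<in> S1SP_theorems"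
proof -
  let ?p = "PImp (PAnd (PVar 0) (PVar 1)) (PVar 0)"
  have "tautology ?p" by (simp add: tautology_def)
  from S1SP_T[OF S1SP_box_taut[OF this, of "\<lambda>n. if n = 0 then \<phi> \<rightarrow>\<^sub>\<box> \<psi> else \<psi> \<rightarrow>\<^sub>\<box> \<phi>"]]
  have "((\<phi> \<leftrightarrow>\<^sub>\<box> \<psi>) \<rightarrow>\<^sub>\<box> (\<phi> \<rightarrow>\<^sub>\<box> \<psi>)) \<in> S1SP_theorems" by simp
  then show ?thesis by (rule S1SP_theorems.MP[OF S1SP_T[OF assms]])
qed

lemma S1SP_id_subst:
  "(\<phi> \<equiv>\<^sub>\<box> \<psi>) \<in> S1SP_theorems \<Longrightarrow> (subst_box \<chi> x \<phi> \<equiv>\<^sub>\<box> subst_box \<chi> x \<psi>) \<in> S1SP_theorems"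
  by (rule S1SP_theorems.MP[OF _ S1SP_theorems.SP])

text \<open>The second identity, fed into SP, replaces \<psi> by \<chi> inside the first one. The
  resulting identity between two identities yields an implication, to which MP applies.\<close>

lemma S1SP_id_trans:
  assumes "(\<phi> \<equiv>\<^sub>\<box> \<psi>) \<in> S1SP_theorems" "(\<psi> \<equiv>\<^sub>\<box> \<chi>) \<in> S1SP_theorems"
  shows "(\<phi> \<equiv>\<^sub>\<box> \<chi>) \<in> S1SP_theorems"
proof -
  \<comment> \<open>With \<open>x\<close> fresh for \<phi>, substituting for \<open>x\<close> in
    \<open>\<phi> \<equiv>\<^sub>\<box> VarB x\<close> changes only the right-hand argument.\<close>
  obtain x where [simp]: "\<And>\<xi>. subst_box \<phi> x \<xi> = \<phi>" using eventually_subst_box_fresh by blast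
  have "((\<phi> \<equiv>\<^sub>\<box> \<psi>) \<equiv>\<^sub>\<box> (\<phi> \<equiv>\<^sub>\<box> \<chi>)) \<in> S1SP_theorems"
    using S1SP_id_subst[OF assms(2), of "\<phi> \<equiv>\<^sub>\<box> VarB x" x] by simp
  from S1SP_theorems.MP[OF assms(1) S1SP_id_imp[OF this]] show ?thesis .
qed

lemma S1SP_id_Neg:
  "(\<phi> \<equiv>\<^sub>\<box> \<psi>) \<in> S1SP_theorems \<Longrightarrow> ((\<not>\<^sub>\<box> \<phi>) \<equiv>\<^sub>\<box> (\<not>\<^sub>\<box> \<psi>)) \<in> S1SP_theorems"
  using S1SP_id_subst[of \<phi> \<psi> "\<not>\<^sub>\<box> (VarB 0)" 0] by simp

lemma S1SP_id_Box:
  "(\<phi> \<equiv>\<^sub>\<box> \<psi>) \<in> S1SP_theorems \<Longrightarrow> ((\<box>\<^sub>\<box> \<phi>) \<equiv>\<^sub>\<box> (\<box>\<^sub>\<box> \<psi>)) \<in> S1SP_theorems"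
  using S1SP_id_subst[of \<phi> \<psi> "\<box>\<^sub>\<box> (VarB 0)" 0] by simp

text \<open>SP substitutes for a single variable, so the arguments are exchanged one after the
  other, with \<open>c \<psi>\<^sub>1 \<phi>\<^sub>2\<close> as the intermediate formula.\<close>

lemma S1SP_id_bin:
  assumes "c \<in> {OrB, AndB, ImpB}"
    and "(\<phi>\<^sub>1 \<equiv>\<^sub>\<box> \<psi>\<^sub>1) \<in> S1SP_theorems" "(\<phi>\<^sub>2 \<equiv>\<^sub>\<box> \<psi>\<^sub>2) \<in> S1SP_theorems"
  shows "((c \<phi>\<^sub>1 \<phi>\<^sub>2) \<equiv>\<^sub>\<box> (c \<psi>\<^sub>1 \<psi>\<^sub>2)) \<in> S1SP_theorems"
proof (rule S1SP_id_trans)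
  \<comment> \<open>As \<open>c\<close> is a variable, the recursion equations of
    \<open>subst_box\<close> apply only after a case split over the three connectives.\<close>
  have subst_c: "subst_box (c \<chi> \<xi>) x \<phi> = c (subst_box \<chi> x \<phi>) (subst_box \<xi> x \<phi>)" for \<chi> \<xi> x \<phi>
    using assms(1) by auto
  obtain x where "\<And>\<xi>. subst_box \<phi>\<^sub>2 x \<xi> = \<phi>\<^sub>2" using eventually_subst_box_fresh by blast
  then show "((c \<phi>\<^sub>1 \<phi>\<^sub>2) \<equiv>\<^sub>\<box> (c \<psi>\<^sub>1 \<phi>\<^sub>2)) \<in> S1SP_theorems"
    using S1SP_id_subst[OF assms(2), of "c (VarB x) \<phi>\<^sub>2" x] by (simp add: subst_c)
  obtain y where "\<And>\<xi>. subst_box \<psi>\<^sub>1 y \<xi> = \<psi>\<^sub>1" using eventually_subst_box_fresh by blast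
  then show "((c \<psi>\<^sub>1 \<phi>\<^sub>2) \<equiv>\<^sub>\<box> (c \<psi>\<^sub>1 \<psi>\<^sub>2)) \<in> S1SP_theorems"
    using S1SP_id_subst[OF assms(3), of "c \<psi>\<^sub>1 (VarB y)" y] by (simp add: subst_c)
qed

lemma S1SP_id_box_tr_id_tr: "(\<phi> \<equiv>\<^sub>\<box> box_tr (id_tr \<phi>)) \<in> S1SP_theorems"
proof (induction \<phi>)
  case (BoxB \<phi>)
  show ?case
    \<comment> \<open>Writing \<phi>' for \<open>box_tr (id_tr \<phi>)\<close>, the round trip of
      the boxed \<phi> is the boxed
      \<open>\<phi>' \<leftrightarrow>\<^sub>\<box> \<top>\<^sub>\<box>\<close>. The chain from
      \<phi> through \<phi>' to this biconditional is built first and then put under the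
      box.\<close>
    using S1SP_id_Box[OF S1SP_id_trans[OF BoxB.IH S1SP_id_iff_Top]] by simp
qed (simp_all add: S1SP_id_refl S1SP_id_Neg S1SP_id_bin)

lemma SCI_conjI:
  assumes "\<phi> \<in> SCI_theorems \<A>" "\<psi> \<in> SCI_theorems \<A>"
  shows "(\<phi> \<and>\<^sub>\<equiv> \<psi>) \<in> SCI_theorems \<A>"
proof -
  let ?p = "PImp (PVar 0) (PImp (PVar 1) (PAnd (PVar 0) (PVar 1)))"
  have "tautology ?p" by (simp add: tautology_def)
  from SCI_theorems.ax[OF SCI_axioms.taut[OF this, of "\<lambda>n. if n = 0 then \<phi> else \<psi>"]]
  have "(\<phi> \<rightarrow>\<^sub>\<equiv> (\<psi> \<rightarrow>\<^sub>\<equiv> (\<phi> \<and>\<^sub>\<equiv> \<psi>))) \<in> SCI_theorems \<A>" by simp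
  from SCI_theorems.MP[OF assms(2) SCI_theorems.MP[OF assms(1) this]] show ?thesis .
qed

lemma SCI_id_refl: "(\<phi> \<equiv>\<^sub>\<equiv> \<phi>) \<in> SCI_theorems \<A>"
  by (intro SCI_theorems.ax SCI_axioms.refl)

lemma SCI_id_Neg:
  "(\<phi> \<equiv>\<^sub>\<equiv> \<psi>) \<in> SCI_theorems \<A> \<Longrightarrow> ((\<not>\<^sub>\<equiv> \<phi>) \<equiv>\<^sub>\<equiv> (\<not>\<^sub>\<equiv> \<psi>)) \<in> SCI_theorems \<A>"
  by (rule SCI_theorems.MP[OF _ SCI_theorems.ax[OF SCI_axioms.cong_Neg]])

lemma SCI_id_bin:
  assumes "c \<in> {OrE, AndE, ImpE, IdE}"
    and "(\<phi>\<^sub>1 \<equiv>\<^sub>\<equiv> \<psi>\<^sub>1) \<in> SCI_theorems \<A>" "(\<phi>\<^sub>2 \<equiv>\<^sub>\<equiv> \<psi>\<^sub>2) \<in> SCI_theorems \<A>"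
  shows "((c \<phi>\<^sub>1 \<phi>\<^sub>2) \<equiv>\<^sub>\<equiv> (c \<psi>\<^sub>1 \<psi>\<^sub>2)) \<in> SCI_theorems \<A>"
  using SCI_theorems.MP[OF SCI_conjI[OF assms(2,3)]
      SCI_theorems.ax[OF SCI_axioms.cong_bin[OF assms(1)]]] .

text \<open>Identity is itself among the connectives that respect identity: replacing \<psi> by
  \<chi> in its second argument identifies the first hypothesis with the goal.\<close>

lemma SCI_id_trans:
  assumes "(\<phi> \<equiv>\<^sub>\<equiv> \<psi>) \<in> SCI_theorems \<A>" "(\<psi> \<equiv>\<^sub>\<equiv> \<chi>) \<in> SCI_theorems \<A>"
  shows "(\<phi> \<equiv>\<^sub>\<equiv> \<chi>) \<in> SCI_theorems \<A>"
proof -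
  have "((\<phi> \<equiv>\<^sub>\<equiv> \<psi>) \<equiv>\<^sub>\<equiv> (\<phi> \<equiv>\<^sub>\<equiv> \<chi>)) \<in> SCI_theorems \<A>"
    by (rule SCI_id_bin[of IdE, OF _ SCI_id_refl assms(2)]) simp
  then have "((\<phi> \<equiv>\<^sub>\<equiv> \<psi>) \<rightarrow>\<^sub>\<equiv> (\<phi> \<equiv>\<^sub>\<equiv> \<chi>)) \<in> SCI_theorems \<A>"
    by (rule SCI_theorems.MP[OF _ SCI_theorems.ax[OF SCI_axioms.elim]])
  then show ?thesis by (rule SCI_theorems.MP[OF assms(1)])
qed

lemma SCI_id_id_tr_box_tr:
  assumes "\<And>\<chi> \<psi>. ((\<chi> \<equiv>\<^sub>\<equiv> \<psi>) \<equiv>\<^sub>\<equiv> (\<box>\<^sub>\<equiv> (\<chi> \<leftrightarrow>\<^sub>\<equiv> \<psi>))) \<in> SCI_theorems \<A>"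
  shows "(\<phi> \<equiv>\<^sub>\<equiv> id_tr (box_tr \<phi>)) \<in> SCI_theorems \<A>"
proof (induction \<phi>)
  case (IdE \<phi> \<psi>)
  show ?case
    \<comment> \<open>Congruence moves both arguments to their round trips. The assumption,
      instantiated at these round trips, then turns their identity into the boxed biconditional that
      \<open>id_tr\<close> produces.\<close>
    using SCI_id_trans[OF SCI_id_bin[of IdE, OF _ IdE.IH] assms] by simp
qed (simp_all add: SCI_id_refl SCI_id_Neg SCI_id_bin)

theorem theorem5p2:
  shows "(\<forall>L. modal_logic_containing_S1SP L \<longrightarrow>
           (\<forall>\<phi> :: fm_box. (\<phi> \<equiv>\<^sub>\<box> box_tr (id_tr \<phi>)) \<in> L))
       \<and> (\<forall>L. axiomatic_extension_SCI L \<longrightarrow>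
           (\<forall>\<chi> \<psi>. ((\<chi> \<equiv>\<^sub>\<equiv> \<psi>) \<equiv>\<^sub>\<equiv> (\<box>\<^sub>\<equiv> (\<chi> \<leftrightarrow>\<^sub>\<equiv> \<psi>))) \<in> L) \<longrightarrow>
           (\<forall>\<phi> :: fm_eq. (\<phi> \<equiv>\<^sub>\<equiv> id_tr (box_tr \<phi>)) \<in> L))"
  \<comment> \<open>The modal half is already a theorem of S1SP and passes to \<open>L\<close> by
    inclusion; in the other half \<open>L\<close> is \<open>SCI_theorems \<A>\<close> for some
    \<open>\<A>\<close>.\<close>
  using S1SP_id_box_tr_id_tr SCI_id_id_tr_box_tr
  unfolding modal_logic_containing_S1SP_def axiomatic_extension_SCI_def by blast

end
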